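(* Let $G$ be a $BSP$-$2$-group, i.e. a $BSP$-group which is a $2$-group. Then $G$ is a finite group.
   Context: For a periodic group $G$, $\pi(G)$ denotes the set of all primes dividing the order of some element of $G$. A group $G$ is called a $BSP$-group if each element of $G$ has (finite) prime power order (the identity, of order $1$, is allowed) and for each $p\in\pi(G)$ there exists a positive integer $v_p$ such that each finite $p$-subgroup of $G$ has order $p^j\leq p^{v_p}$. A $2$-group is a (not necessarily finite) group in which every element has order a power of $2$. *)

theory Defs
  imports "HOL-Algebra.Multiplicative_Group" "HOL-Computational_Algebra.Primes"
begin

(* group.ord G x is 0 exactly when x has infinite order. Hence group.ord G x = p ^ k with p prime
   includes finiteness of the order, and k = 0 covers the identity. *)

definition p_group :: "nat \<Rightarrow> ('a, 'b) monoid_scheme \<Rightarrow> bool" where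
  "p_group p G \<longleftrightarrow>
     group G \<and> prime p \<and> (\<forall>x\<in>carrier G. \<exists>k::nat. group.ord G x = p ^ k)"

(* Meant for periodic G only: since every prime divides 0, an element of infinite order would put
   every prime into this set. *)
definition prime_spectrum :: "('a, 'b) monoid_scheme \<Rightarrow> nat set" where
  "prime_spectrum G = {p. prime p \<and> (\<exists>x\<in>carrier G. p dvd group.ord G x)}"

definition BSP_group :: "('a, 'b) monoid_scheme \<Rightarrow> bool" where
  "BSP_group G \<longleftrightarrow>
     group G \<and>
     (\<forall>x\<in>carrier G. \<exists>(p::nat) k::nat. prime p \<and> group.ord G x = p ^ k) \<and>
     (\<forall>p\<in>prime_spectrum G. \<exists>v::nat. v > 0 \<and>
        (\<forall>H. subgroup H G \<and> finite H \<and> p_group p (G\<lparr>carrier := H\<rparr>) \<longrightarrow>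
           (\<exists>j::nat. card H = p ^ j \<and> p ^ j \<le> p ^ v)))"

end

theory Submission
  imports Defs "HOL-Algebra.Group_Action"
begin

text \<open>
  In a 2-group \<open>G\<close> whose finite subgroups have bounded order, every finite subgroup lies in a maximal
  one. The theorem amounts to saying that there is only one maximal finite subgroup \<open>M\<close>: each element
  generates a finite cyclic group, which then lies in \<open>M\<close>, so that \<open>G = M\<close>.

  For uniqueness, suppose there are two different maximal finite subgroups, and among all such pairs
  choose \<open>A\<close>, \<open>C\<close> with \<open>D = A \<inter> C\<close> of largest order. By maximality \<open>D\<close> is proper in both. Normalizers grow
  in finite 2-groups, so \<open>A\<close> and \<open>C\<close> contain elements \<open>x\<close> and \<open>y\<close> outside \<open>D\<close> that normalize \<open>D\<close> and are
  involutions modulo \<open>D\<close> (lemma \<open>normalizer_grows_by_involution\<close>). Two involutions whose product has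
  finite order generate a finite dihedral group, so \<open>D\<close>, \<open>x\<close> and \<open>y\<close> lie in a common finite subgroup
  (lemma \<open>finite_dihedral_extension\<close>), hence in a maximal one, \<open>L\<close>. Now \<open>L \<inter> A\<close> contains \<open>D\<close> and \<open>x\<close>, so it
  is larger than \<open>D\<close>, and the choice of the pair forces \<open>L = A\<close>. Likewise \<open>L = C\<close>, a contradiction.
  It is the dihedral step that is special to the prime 2.

  Everything modulo \<open>D\<close> is phrased inside \<open>G\<close>, with the condition \<open>x \<otimes> d \<otimes> inv x \<in> D\<close> for all \<open>d \<in> D\<close>
  in place of a passage to the quotient of the normalizer of \<open>D\<close>.
\<close>

section \<open>Growth of normalizers in finite p-groups\<close>

text \<open>
  Orbits of a \<open>p\<close>-group have \<open>p\<close>-power size, so the number of fixed points in \<open>X\<close> is divisible by \<open>p\<close>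
  whenever \<open>card X\<close> is; in particular it is not 1.
\<close>

lemma (in group_action) another_fixed_point:
  assumes p: "prime p" and order: "order G = p ^ n"
    and X: "X \<subseteq> E" "finite X" "\<And>g x. g \<in> carrier G \<Longrightarrow> x \<in> X \<Longrightarrow> \<phi> g x \<in> X"
    and dvd: "p dvd card X"
    and x: "x \<in> X" "\<And>g. g \<in> carrier G \<Longrightarrow> \<phi> g x = x"
  obtains y where "y \<in> X" "y \<noteq> x" "\<And>g. g \<in> carrier G \<Longrightarrow> \<phi> g y = y"
proof -
  interpret group G
    using group_hom group_hom.axioms(1) by blast
  have orbit_sub: "orbit G \<phi> y \<subseteq> X" if "y \<in> X" for y
    using X(3) that by (auto simp: orbit_def)
  have orbit_self: "y \<in> orbit G \<phi> y" if "y \<in> X" for y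
    using orbit_refl X(1) that by blast
  have orbit_x: "orbit G \<phi> x = {x}"
    using x orbit_self[OF x(1)] by (auto simp: orbit_def)
  let ?O = "orbit G \<phi> ` X"
  have card_X: "card X = sum card ?O"
  proof -
    have "X = \<Union> ?O"
      using orbit_sub orbit_self by blast
    moreover have "pairwise disjnt ?O"
    proof (rule pairwiseI)
      fix A B assume "A \<in> ?O" "B \<in> ?O" "A \<noteq> B"
      then show "disjnt A B"
        using disjoint_union[of A B] X(1) by (auto simp: orbits_def disjnt_def)
    qed
    moreover have "finite A" if "A \<in> ?O" for A
      using that orbit_sub X(2) finite_subset by blast
    ultimately show ?thesis
      using card_Union_disjoint[of ?O] by simp
  qed
  have "\<exists>y\<in>X. y \<noteq> x \<and> (\<forall>g\<in>carrier G. \<phi> g y = y)"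
  proof (rule ccontr)
    assume no: "\<not> ?thesis"
    have "p dvd card A" if A: "A \<in> ?O - {{x}}" for A
    proof -
      obtain y where y: "y \<in> X" "A = orbit G \<phi> y"
        using A by blast
      then have "y \<noteq> x"
        using A orbit_x by blast
      then obtain g where g: "g \<in> carrier G" "\<phi> g y \<noteq> y"
        using no y by blast
      have "{y, \<phi> g y} \<subseteq> A"
        using y orbit_self g by (auto simp: orbit_def)
      moreover have "finite A"
        using y orbit_sub X(2) finite_subset by blast
      ultimately have "card {y, \<phi> g y} \<le> card A"
        by (rule card_mono[rotated])
      then have "card A \<noteq> 1"
        using g by simp
      moreover have "card A dvd p ^ n"
        using orbit_stabilizer_theorem[of y] y X(1) order by (metis dvd_triv_left subsetD)
      ultimately show ?thesis
        using p by (metis divides_primepow_nat dvd_power not_gr_zero power_0)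
    qed
    then have "p dvd sum card (?O - {{x}})"
      by (rule dvd_sum)
    moreover have "sum card ?O = card {x} + sum card (?O - {{x}})"
      using orbit_x x(1) X(2) by (intro sum.remove) (auto simp: image_iff)
    ultimately have "p dvd 1"
      using dvd card_X by (metis card_1_singleton_iff dvd_add_left_iff One_nat_def)
    then show False
      using p by simp
  qed
  then show thesis
    using that by blast
qed

text \<open>
  Suppose \<open>D\<close> were its own normalizer in \<open>M\<close>. Then \<open>D\<close> has \<open>card M / card D\<close> conjugates under \<open>M\<close>, a number
  divisible by \<open>p\<close>. Let \<open>D\<close> act on them by conjugation: it fixes itself, so it fixes (that is,
  normalizes) another conjugate \<open>H\<close>. But \<open>H\<close> is its own normalizer too, so \<open>D \<subseteq> H\<close>, and comparing
  orders gives \<open>D = H\<close>.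
\<close>

lemma (in group) normalizer_grows:
  assumes p: "prime p" and M: "subgroup M G" "card M = p ^ m"
    and D: "subgroup D G" "D \<subset> M"
  obtains x where "x \<in> M" "x \<notin> D" "\<And>d. d \<in> D \<Longrightarrow> x \<otimes> d \<otimes> inv x \<in> D"
proof -
  define \<phi> where "\<phi> = (\<lambda>g. \<lambda>H \<in> {H. subgroup H G}. (g <# H) #> inv g)"
  interpret G_act: group_action G "{H. subgroup H G}" \<phi>
    unfolding \<phi>_def by (rule action_by_conjugation_on_subgroups_set)
  interpret M_act: group_action "G\<lparr>carrier := M\<rparr>" "{H. subgroup H G}" \<phi>
    using G_act.induced_action M(1) .
  interpret D_act: group_action "G\<lparr>carrier := D\<rparr>" "{H. subgroup H G}" \<phi>
    using G_act.induced_action D(1) .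
  have fin_M: "finite M"
    using M(2) p by (metis card_gt_0_iff prime_gt_0_nat zero_less_power)
  have M_carrier: "M \<subseteq> carrier G" and D_carrier: "D \<subseteq> carrier G"
    using M(1) D(1) subgroup.subset by blast+
  have conj_mem: "g \<otimes> d \<otimes> inv g \<in> \<phi> g D" if "d \<in> D" for g d
    using that D(1) by (auto simp: \<phi>_def l_coset_def r_coset_def)
  have fixed_D: "\<phi> d D = D" if "d \<in> D" for d
    using that D(1) D_carrier subgroup.m_inv_closed[OF D(1)] subgroup.m_closed[OF D(1)]
    by (simp add: \<phi>_def coset_join2 coset_join3 subset_iff)
  have "\<exists>x\<in>M. x \<notin> D \<and> \<phi> x D = D"
  proof (rule ccontr)
    assume self_norm: "\<not> ?thesis"
    let ?X = "orbit (G\<lparr>carrier := M\<rparr>) \<phi> D"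
    have stab: "stabilizer (G\<lparr>carrier := M\<rparr>) \<phi> D = D"
      using self_norm fixed_D D(2) by (auto simp: stabilizer_def)
    have card: "card ?X * card D = p ^ m"
      using M_act.orbit_stabilizer_theorem[of D] D(1) M(2) stab by (simp add: order_def)
    have "card D < p ^ m"
      using psubset_card_mono[OF fin_M D(2)] M(2) by simp
    then have "card ?X \<noteq> 1"
      using card by auto
    moreover have "card ?X dvd p ^ m" "card D dvd p ^ m"
      using card by (metis dvd_triv_left, metis dvd_triv_right)
    ultimately have dvd: "p dvd card ?X"
      using p by (metis divides_primepow_nat dvd_power not_gr_zero power_0)
    obtain n where n: "card D = p ^ n"
      using \<open>card D dvd p ^ m\<close> p divides_primepow_nat by blast
    have X_sub: "?X \<subseteq> {H. subgroup H G}"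
    proof
      fix H assume "H \<in> ?X"
      then obtain k where "k \<in> M" "H = \<phi> k D"
        by (auto simp: orbit_def)
      then show "H \<in> {H. subgroup H G}"
        using M_act.element_image[of k D] D(1) by simp
    qed
    have X_fin: "finite ?X"
      using fin_M by (simp add: orbit_def)
    have X_closed: "\<phi> g H \<in> ?X" if g: "g \<in> D" and H: "H \<in> ?X" for g H
    proof -
      obtain k where k: "k \<in> M" "H = \<phi> k D"
        using H by (auto simp: orbit_def)
      have "\<phi> g H = \<phi> (g \<otimes> k) D"
        using G_act.composition_rule[of D g k] D(1) g k D_carrier M_carrier by auto
      moreover have "g \<otimes> k \<in> M"
        using g k D(2) subgroup.m_closed[OF M(1)] by blast
      ultimately show ?thesis
        by (auto simp: orbit_def)
    qed
    have D_X: "D \<in> ?X"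
      using M_act.orbit_refl D(1) by simp
    obtain H where H: "H \<in> ?X" "H \<noteq> D" "\<And>g. g \<in> D \<Longrightarrow> \<phi> g H = H"
      using D_act.another_fixed_point[OF p _ X_sub X_fin _ dvd D_X] n X_closed fixed_D
      by (auto simp: order_def)
    obtain k where k: "k \<in> M" "H = \<phi> k D"
      using H(1) by (auto simp: orbit_def)
    have k': "k \<in> carrier G" "inv k \<in> M"
      using k M_carrier subgroup.m_inv_closed[OF M(1)] by auto
    \<comment> \<open>Conjugating by \<open>k\<close> carries the self-normalization of \<open>D\<close> over to \<open>H\<close>.\<close>
    have "D \<subseteq> H"
    proof
      fix d assume d: "d \<in> D"
      let ?c = "inv k \<otimes> d \<otimes> k"
      have d': "d \<in> carrier G" "d \<in> M"
        using d D_carrier D(2) by auto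
      have "\<phi> ?c D = \<phi> (inv k) (\<phi> d (\<phi> k D))"
        using G_act.composition_rule[of D "inv k \<otimes> d" k] D(1) k' d'
          G_act.composition_rule[of "\<phi> k D" "inv k" d] G_act.element_image[of k D]
        by simp
      also have "\<dots> = \<phi> (inv k) (\<phi> k D)"
        using H(3) d k by simp
      also have "\<dots> = \<phi> (inv k \<otimes> k) D"
        using G_act.composition_rule[of D "inv k" k] D(1) k' by simp
      also have "\<dots> = D"
        using k' fixed_D subgroup.one_closed[OF D(1)] by simp
      finally have "\<phi> ?c D = D" .
      moreover have "?c \<in> M"
        using k(1) k'(2) d'(2) subgroup.m_closed[OF M(1)] by simp
      ultimately have "?c \<in> D"
        using self_norm by blast
      then have "k \<otimes> ?c \<otimes> inv k \<in> H"
        using conj_mem k by simp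
      moreover have "k \<otimes> ?c \<otimes> inv k = d"
        using k' d' by (simp add: m_assoc) (simp flip: m_assoc)
      ultimately show "d \<in> H"
        by simp
    qed
    moreover have "H = (\<lambda>d. k \<otimes> d \<otimes> inv k) ` D"
      using k D(1) by (auto simp: \<phi>_def l_coset_def r_coset_def)
    then have "card H \<le> card D" "finite H"
      using card_image_le finite_subset fin_M D(2) by blast+
    ultimately have "D = H"
      by (metis card_seteq)
    then show False
      using H(2) by simp
  qed
  then obtain x where "x \<in> M" "x \<notin> D" "\<phi> x D = D"
    by blast
  then show thesis
    using that conj_mem by blast
qed

text \<open>
  Squaring \<open>x\<close> repeatedly ends in the identity; the last power outside \<open>D\<close> is an involution modulo \<open>D\<close>.
\<close>

lemma (in group) involution_modulo_subgroup:
  assumes D: "subgroup D G" and x: "x \<in> carrier G" "x \<notin> D" "ord x = 2 ^ k"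
  obtains i :: nat where "x [^] i \<notin> D" "x [^] i \<otimes> x [^] i \<in> D"
proof -
  let ?P = "\<lambda>l. x [^] (2 ^ l :: nat) \<in> D"
  have "x [^] ord x \<in> D"
    using x(1) subgroup.one_closed[OF D] by simp
  then have "?P k"
    using x(3) by simp
  moreover have "\<not> ?P 0"
    using x by simp
  ultimately obtain l where "\<not> ?P l" "?P (Suc l)"
    using ex_least_nat_less[of ?P k] by blast
  then show thesis
    using that[of "2 ^ l"] x by (simp add: nat_pow_mult mult_2)
qed

lemma (in group) conj_pow_closed:
  assumes H: "subgroup H G" and x: "x \<in> carrier G"
    and conj: "\<And>h. h \<in> H \<Longrightarrow> x \<otimes> h \<otimes> inv x \<in> H" and h: "h \<in> H"
  shows "x [^] (i::nat) \<otimes> h \<otimes> inv (x [^] i) \<in> H"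
proof (induction i)
  case 0
  then show ?case
    using h subgroup.mem_carrier[OF H] by simp
next
  case (Suc i)
  have "x [^] Suc i \<otimes> h \<otimes> inv (x [^] Suc i) = x \<otimes> (x [^] i \<otimes> h \<otimes> inv (x [^] i)) \<otimes> inv x"
    using x subgroup.mem_carrier[OF H h] nat_pow_Suc2[OF x]
    by (simp add: m_assoc inv_mult_group del: nat_pow_Suc)
  then show ?case
    using conj Suc by simp
qed

lemma (in group) normalizer_grows_by_involution:
  assumes M: "subgroup M G" "card M = 2 ^ m" and D: "subgroup D G" "D \<subset> M"
    and ord: "\<And>x. x \<in> carrier G \<Longrightarrow> \<exists>k. ord x = 2 ^ k"
  obtains x where "x \<in> M" "x \<notin> D" "x \<otimes> x \<in> D" "\<And>d. d \<in> D \<Longrightarrow> x \<otimes> d \<otimes> inv x \<in> D"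
proof -
  obtain w where w: "w \<in> M" "w \<notin> D" "\<And>d. d \<in> D \<Longrightarrow> w \<otimes> d \<otimes> inv w \<in> D"
    using normalizer_grows[OF two_is_prime_nat M D] by blast
  have wG: "w \<in> carrier G"
    using w(1) subgroup.mem_carrier[OF M(1)] by simp
  obtain i :: nat where i: "w [^] i \<notin> D" "w [^] i \<otimes> w [^] i \<in> D"
    using involution_modulo_subgroup[OF D(1) wG w(2)] ord[OF wG] by blast
  have "w [^] i \<in> M"
    using w(1) subgroup.m_closed[OF M(1)] subgroup.one_closed[OF M(1)] by (induction i) auto
  then show thesis
    using that i conj_pow_closed[OF D(1) wG w(3)] by blast
qed

section \<open>Finite extensions of a finite subgroup by normalizing elements\<close>

lemma (in group) conj_of_pow:
  assumes "x \<in> carrier G" "z \<in> carrier G"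
  shows "x \<otimes> z [^] (i::nat) \<otimes> inv x = (x \<otimes> z \<otimes> inv x) [^] i"
proof (induction i)
  case (Suc i)
  have "x \<otimes> z [^] Suc i \<otimes> inv x = (x \<otimes> z [^] i \<otimes> inv x) \<otimes> (x \<otimes> z \<otimes> inv x)"
    using assms by (simp add: m_assoc) (simp flip: m_assoc)
  then show ?case
    using Suc by simp
qed (use assms in simp)

text \<open>
  The set \<open>K\<close> is the product of \<open>H\<close> with the cyclic group of \<open>z\<close>. As \<open>z\<close> normalizes \<open>H\<close>, powers of \<open>z\<close> can be
  moved to the right past elements of \<open>H\<close>. Exponents range over the natural numbers, which yields
  inverses because \<open>z\<close> has finite order.
\<close>

lemma (in group) finite_cyclic_extension:
  assumes H: "subgroup H G" "finite H" and z: "z \<in> carrier G" "ord z \<noteq> 0"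
    and conj: "\<And>h. h \<in> H \<Longrightarrow> z \<otimes> h \<otimes> inv z \<in> H"
  defines "K \<equiv> {h \<otimes> z [^] i | h i. h \<in> H \<and> i \<in> (UNIV :: nat set)}"
  shows "subgroup K G" "finite K" "H \<subseteq> K" "z \<in> K"
proof -
  note HC = subgroup.mem_carrier[OF H(1)]
  have prod: "z [^] i \<otimes> h \<in> K" if h: "h \<in> H" for h and i :: nat
  proof -
    have "z [^] i \<otimes> h = (z [^] i \<otimes> h \<otimes> inv (z [^] i)) \<otimes> z [^] i"
      using z HC[OF h] by (simp add: m_assoc)
    then show ?thesis
      using conj_pow_closed[OF H(1) z(1) conj h] unfolding K_def by blast
  qed
  have left: "h \<otimes> k \<in> K" if h: "h \<in> H" and kK: "k \<in> K" for h k
  proof -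
    obtain h' and i :: nat where k: "h' \<in> H" "k = h' \<otimes> z [^] i"
      using kK by (auto simp: K_def)
    have "h \<otimes> k = (h \<otimes> h') \<otimes> z [^] i"
      using k h HC z by (simp add: m_assoc)
    then show ?thesis
      using subgroup.m_closed[OF H(1)] h k unfolding K_def by blast
  qed
  have right: "k \<otimes> z [^] j \<in> K" if kK: "k \<in> K" for k and j :: nat
  proof -
    obtain h' and i :: nat where k: "h' \<in> H" "k = h' \<otimes> z [^] i"
      using kK by (auto simp: K_def)
    have "k \<otimes> z [^] j = h' \<otimes> z [^] (i + j)"
      using k HC z by (simp add: m_assoc nat_pow_mult)
    then show ?thesis
      using k unfolding K_def by blast
  qed
  show HK: "H \<subseteq> K"
  proof
    fix h assume h: "h \<in> H"
    then show "h \<in> K"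
      using prod[of h 0] HC by simp
  qed
  show zK: "z \<in> K"
    using prod[of \<one> 1] subgroup.one_closed[OF H(1)] z by simp
  show "subgroup K G"
  proof (rule subgroupI)
    show "K \<subseteq> carrier G"
      using HC z by (auto simp: K_def)
    show "K \<noteq> {}"
      using zK by blast
  next
    fix a assume "a \<in> K"
    then obtain h and i :: nat where a: "h \<in> H" "a = h \<otimes> z [^] i"
      by (auto simp: K_def)
    have "i * (ord z - 1) + i = ord z * i"
      using z(2) by (cases "ord z") auto
    then have "z [^] (i * (ord z - 1)) \<otimes> z [^] i = (z [^] ord z) [^] i"
      using z(1) nat_pow_mult nat_pow_pow by metis
    then have "inv (z [^] i) = z [^] (i * (ord z - 1))"
      using z(1) by (intro inv_equality) simp_all
    then have "inv a = z [^] (i * (ord z - 1)) \<otimes> inv h"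
      using a HC z by (simp add: inv_mult_group)
    then show "inv a \<in> K"
      using prod subgroup.m_inv_closed[OF H(1)] a by simp
  next
    fix a b assume "a \<in> K" "b \<in> K"
    then obtain h h' and i j :: nat
      where a: "h \<in> H" "a = h \<otimes> z [^] i" and b: "h' \<in> H" "b = h' \<otimes> z [^] j"
      by (auto simp: K_def)
    have "a \<otimes> b = h \<otimes> (z [^] i \<otimes> h' \<otimes> z [^] j)"
      using a b HC z by (simp add: m_assoc)
    then show "a \<otimes> b \<in> K"
      using left right prod a b by simp
  qed
  have "K \<subseteq> (\<lambda>(h, i). h \<otimes> z [^] i) ` (H \<times> {..<ord z})"
  proof
    fix k assume "k \<in> K"
    then obtain h and i :: nat where k: "h \<in> H" "k = h \<otimes> z [^] i"
      by (auto simp: K_def)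
    have "z [^] i = z [^] (ord z * (i div ord z) + i mod ord z)"
      by simp
    also have "\<dots> = (z [^] ord z) [^] (i div ord z) \<otimes> z [^] (i mod ord z)"
      using z(1) nat_pow_mult nat_pow_pow nat_pow_closed by metis
    also have "\<dots> = z [^] (i mod ord z)"
      using z(1) by simp
    finally have "k = (\<lambda>(h, i). h \<otimes> z [^] i) (h, i mod ord z)"
      using k by simp
    moreover have "(h, i mod ord z) \<in> H \<times> {..<ord z}"
      using k z(2) by simp
    ultimately show "k \<in> (\<lambda>(h, i). h \<otimes> z [^] i) ` (H \<times> {..<ord z})"
      by (rule image_eqI)
  qed
  then show "finite K"
    using H(2) finite_subset by blast
qed

text \<open>
  Modulo \<open>D\<close> the elements \<open>x\<close> and \<open>y\<close> are involutions, so \<open>x\<close> inverts the rotation \<open>z = x \<otimes> y\<close>. Hence \<open>x\<close>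
  normalizes the extension \<open>R\<close> of \<open>D\<close> by \<open>z\<close>, and the group wanted arises from two successive cyclic
  extensions, first by \<open>z\<close> and then by \<open>x\<close>.
\<close>

lemma (in group) finite_dihedral_extension:
  assumes D: "subgroup D G" "finite D"
    and x: "x \<in> carrier G" "x \<otimes> x \<in> D" "\<And>d. d \<in> D \<Longrightarrow> x \<otimes> d \<otimes> inv x \<in> D" "ord x \<noteq> 0"
    and y: "y \<in> carrier G" "y \<otimes> y \<in> D" "\<And>d. d \<in> D \<Longrightarrow> y \<otimes> d \<otimes> inv y \<in> D"
    and xy: "ord (x \<otimes> y) \<noteq> 0"
  obtains K where "subgroup K G" "finite K" "D \<subseteq> K" "x \<in> K" "y \<in> K"
proof -
  note DC = subgroup.mem_carrier[OF D(1)]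
  define z where "z = x \<otimes> y"
  have z: "z \<in> carrier G" "ord z \<noteq> 0"
    using x y xy by (auto simp: z_def)
  have conj_z: "z \<otimes> d \<otimes> inv z \<in> D" if "d \<in> D" for d
  proof -
    have "z \<otimes> d \<otimes> inv z = x \<otimes> (y \<otimes> d \<otimes> inv y) \<otimes> inv x"
      using x(1) y(1) DC[OF that] by (simp add: z_def m_assoc inv_mult_group)
    then show ?thesis
      using x(3) y(3) that by simp
  qed
  define R where "R = {d \<otimes> z [^] i | d i. d \<in> D \<and> i \<in> (UNIV :: nat set)}"
  have R: "subgroup R G" "finite R" "D \<subseteq> R" "z \<in> R"
    using finite_cyclic_extension[OF D z conj_z] by (simp_all add: R_def)
  have pow_R: "r [^] i \<in> R" if "r \<in> R" for r and i :: nat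
    using that subgroup.mem_carrier[OF R(1)] subgroup.m_closed[OF R(1)] subgroup.one_closed[OF R(1)]
    by (induction i) auto
  \<comment> \<open>This is the relation \<open>x z x\<^sup>-\<^sup>1 = z\<^sup>-\<^sup>1\<close> of a dihedral group, up to factors from \<open>D\<close>.\<close>
  have "x \<otimes> z \<otimes> inv x = (x \<otimes> x) \<otimes> (y \<otimes> y) \<otimes> inv z"
    using x(1) y(1) by (simp add: z_def inv_mult_group m_assoc) (simp flip: m_assoc)
  then have xzx: "x \<otimes> z \<otimes> inv x \<in> R"
    using x(2) y(2) R(3,4) subgroup.m_closed[OF R(1)] subgroup.m_inv_closed[OF R(1)]
    by (simp add: subset_iff)
  have conj_x: "x \<otimes> r \<otimes> inv x \<in> R" if rR: "r \<in> R" for r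
  proof -
    obtain d and i :: nat where r: "d \<in> D" "r = d \<otimes> z [^] i"
      using rR by (auto simp: R_def)
    have "x \<otimes> r \<otimes> inv x = (x \<otimes> d \<otimes> inv x) \<otimes> (x \<otimes> z [^] i \<otimes> inv x)"
      using r x(1) z DC by (simp add: m_assoc) (simp flip: m_assoc)
    also have "\<dots> = (x \<otimes> d \<otimes> inv x) \<otimes> (x \<otimes> z \<otimes> inv x) [^] i"
      using conj_of_pow x(1) z by simp
    finally show ?thesis
      using r x(3) R(3) pow_R[OF xzx] subgroup.m_closed[OF R(1)] by (simp add: subset_iff)
  qed
  obtain K where K: "subgroup K G" "finite K" "R \<subseteq> K" "x \<in> K"
    using finite_cyclic_extension[OF R(1,2) x(1,4) conj_x] by blast
  have "y = inv x \<otimes> z"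
    using x(1) y(1) by (simp add: z_def flip: m_assoc)
  then have "y \<in> K"
    using K R(4) subgroup.m_closed[OF K(1)] subgroup.m_inv_closed[OF K(1)] by blast
  then show thesis
    using that K R(3) by blast
qed

section \<open>Uniqueness of the maximal finite subgroup\<close>

text \<open>
  The bound \<open>B\<close> enters twice: it provides maximal finite subgroups, and it provides a pair of them with
  largest intersection.
\<close>

theorem (in group) finite_if_finite_subgroups_bounded:
  assumes ord: "\<And>x. x \<in> carrier G \<Longrightarrow> \<exists>k. ord x = 2 ^ k"
    and card: "\<And>H. subgroup H G \<Longrightarrow> finite H \<Longrightarrow> \<exists>j. card H = 2 ^ j"
    and bound: "\<And>H. subgroup H G \<Longrightarrow> finite H \<Longrightarrow> card H \<le> B"
  shows "finite (carrier G)"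
proof -
  have ord_nz: "ord x \<noteq> 0" if "x \<in> carrier G" for x
    using ord[OF that] by auto
  define maximal where
    "maximal M \<longleftrightarrow> subgroup M G \<and> finite M \<and> (\<forall>L. subgroup L G \<longrightarrow> finite L \<longrightarrow> M \<subseteq> L \<longrightarrow> L = M)" for M
  have ex_maximal: "\<exists>M. maximal M \<and> H \<subseteq> M" if H: "subgroup H G" "finite H" for H
  proof -
    define F where "F = (\<lambda>M. subgroup M G \<and> finite M \<and> H \<subseteq> M)"
    have "F H"
      using H by (simp add: F_def)
    moreover have "\<forall>M. F M \<longrightarrow> card M < Suc B"
      using bound by (auto simp: F_def less_Suc_eq_le)
    ultimately obtain M where M: "F M" "\<And>L. F L \<Longrightarrow> card L \<le> card M"
      using ex_has_greatest_nat[of F H card "Suc B"] by blast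
    have "L = M" if "subgroup L G" "finite L" "M \<subseteq> L" for L
      using that M by (metis F_def card_seteq order_trans)
    then show ?thesis
      using M(1) by (auto simp: F_def maximal_def)
  qed
  have unique: "M = N" if MN: "maximal M" "maximal N" for M N
  proof (rule ccontr)
    assume "M \<noteq> N"
    define P where "P = (\<lambda>(M, N). maximal M \<and> maximal N \<and> M \<noteq> N)"
    have "P (M, N)"
      using MN \<open>M \<noteq> N\<close> by (simp add: P_def)
    moreover have "\<forall>Q. P Q \<longrightarrow> card (fst Q \<inter> snd Q) < Suc B"
      using bound subgroups_Inter_pair by (auto simp: P_def maximal_def less_Suc_eq_le)
    ultimately obtain Q where Q: "P Q"
      "\<And>Q'. P Q' \<Longrightarrow> card (fst Q' \<inter> snd Q') \<le> card (fst Q \<inter> snd Q)"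
      using ex_has_greatest_nat[of P "(M, N)" "\<lambda>Q. card (fst Q \<inter> snd Q)" "Suc B"] by blast
    obtain A C where AC: "Q = (A, C)"
      by force
    have A: "maximal A" "subgroup A G" "finite A" and C: "maximal C" "subgroup C G" "finite C"
      and "A \<noteq> C"
      using Q(1) by (auto simp: AC P_def maximal_def)
    define D where "D = A \<inter> C"
    have D: "subgroup D G" "finite D"
      using A C subgroups_Inter_pair by (auto simp: D_def)
    have largest: "card (A' \<inter> C') \<le> card D" if "maximal A'" "maximal C'" "A' \<noteq> C'" for A' C'
      using Q(2)[of "(A', C')"] that by (simp add: P_def AC D_def)
    have DA: "D \<subset> A" and DC: "D \<subset> C"
      using A C \<open>A \<noteq> C\<close> unfolding D_def maximal_def by blast+
    obtain x where x: "x \<in> A" "x \<notin> D" "x \<otimes> x \<in> D" "\<And>d. d \<in> D \<Longrightarrow> x \<otimes> d \<otimes> inv x \<in> D"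
      using normalizer_grows_by_involution[OF A(2) _ D(1) DA ord] card[OF A(2,3)] by blast
    obtain y where y: "y \<in> C" "y \<notin> D" "y \<otimes> y \<in> D" "\<And>d. d \<in> D \<Longrightarrow> y \<otimes> d \<otimes> inv y \<in> D"
      using normalizer_grows_by_involution[OF C(2) _ D(1) DC ord] card[OF C(2,3)] by blast
    have xy: "x \<in> carrier G" "y \<in> carrier G"
      using x(1) y(1) subgroup.mem_carrier A(2) C(2) by metis+
    obtain K where K: "subgroup K G" "finite K" "D \<subseteq> K" "x \<in> K" "y \<in> K"
      using finite_dihedral_extension[OF D xy(1) x(3,4) ord_nz xy(2) y(3,4) ord_nz] xy by blast
    obtain L where L: "maximal L" "K \<subseteq> L"
      using ex_maximal K by blast
    \<comment> \<open>If \<open>L\<close> and \<open>A'\<close> differed, they would meet in more than \<open>D\<close>, since both contain \<open>w\<close>.\<close>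
    have absorb: "L = A'" if A': "maximal A'" "D \<subset> A'" "w \<in> A'" "w \<notin> D" "w \<in> K" for A' w
    proof (rule ccontr)
      assume "L \<noteq> A'"
      moreover have "D \<subset> L \<inter> A'"
        using A' K(3) L(2) by blast
      moreover have "finite (L \<inter> A')"
        using A' by (simp add: maximal_def)
      ultimately show False
        using largest[OF L(1) A'(1)] psubset_card_mono by (metis not_le)
    qed
    have "L = A" "L = C"
      using absorb[OF A(1) DA x(1,2) K(4)] absorb[OF C(1) DC y(1,2) K(5)] by auto
    then show False
      using \<open>A \<noteq> C\<close> by simp
  qed
  obtain M where M: "maximal M"
    using ex_maximal[OF triv_subgroup] by auto
  have "carrier G \<subseteq> M"
  proof
    fix x assume x: "x \<in> carrier G"
    have "x \<in> carrier (subgroup_generated G {x})"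
      using x by (simp add: carrier_subgroup_generated generate.incl)
    moreover have "subgroup (carrier (subgroup_generated G {x})) G"
      by (rule subgroup_subgroup_generated)
    moreover have "finite (carrier (subgroup_generated G {x}))"
      using finite_cyclic_subgroup_order x ord_nz by blast
    ultimately obtain N where "maximal N" "x \<in> N"
      using ex_maximal by blast
    then show "x \<in> M"
      using unique M by blast
  qed
  then show ?thesis
    using M finite_subset by (auto simp: maximal_def)
qed

theorem theorem8:
  fixes G :: "('a, 'b) monoid_scheme"
  assumes "BSP_group G"
    and "p_group 2 G"
  shows "finite (carrier G)"
proof -
  interpret group G
    using assms(2) by (simp add: p_group_def)
  have ord: "\<exists>k. ord x = 2 ^ k" if "x \<in> carrier G" for x
    using assms(2) that by (simp add: p_group_def)
  show ?thesis
  proof (cases "2 \<in> prime_spectrum G")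
    case True
    then obtain v :: nat where v: "\<And>H. subgroup H G \<Longrightarrow> finite H \<Longrightarrow> p_group 2 (G\<lparr>carrier := H\<rparr>)
        \<Longrightarrow> \<exists>j::nat. card H = 2 ^ j \<and> 2 ^ j \<le> (2::nat) ^ v"
      using assms(1) unfolding BSP_group_def by blast
    \<comment> \<open>Element orders do not change on passing to a subgroup, so every subgroup is a 2-group.\<close>
    have sub: "p_group 2 (G\<lparr>carrier := H\<rparr>)" if H: "subgroup H G" for H
    proof -
      interpret H: group "G\<lparr>carrier := H\<rparr>"
        using subgroup_imp_group[OF H] .
      have "H.ord x = ord x" for x
        unfolding H.ord_def ord_def by (simp flip: nat_pow_consistent)
      then show ?thesis
        using ord subgroup.mem_carrier[OF H] H.is_group by (auto simp: p_group_def)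
    qed
    show ?thesis
      using finite_if_finite_subgroups_bounded[of "2 ^ v"] ord v sub by metis
  next
    \<comment> \<open>The definition gives no bound here, but a 2-group without elements of even order is trivial.\<close>
    case False
    have "x = \<one>\<^bsub>G\<^esub>" if x: "x \<in> carrier G" for x
    proof -
      obtain k where k: "ord x = 2 ^ k"
        using ord[OF x] by blast
      moreover have "\<not> 2 dvd ord x"
        using False x by (auto simp: prime_spectrum_def)
      ultimately have "ord x = 1"
        by (cases k) auto
      then show ?thesis
        using ord_eq_1[OF x] by simp
    qed
    then have "carrier G \<subseteq> {\<one>\<^bsub>G\<^esub>}"
      by blast
    then show ?thesis
      using finite_subset by blast
  qed
qed

end
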